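(* Let $m\geq 3$ be an odd composite integer. If there exist $p$ and a positive integer $q$ such that $p$ is a prime divisor of $m$, $q\vartriangleleft m$ and $q\equiv -1\pmod{p}$, then $m$ is an absent number. Otherwise (i.e. if no such pair $(p,q)$ exists) there exists an integer $s\geq 1$ such that $b_m^s=m$, and in consequence $m$ is a present number.
   Context: For each integer $s\geq 1$, the sequence $(a_n^s)_{n\ge 1}$ of positive integers (here $s$ is an upper index, not an exponent) is defined by $a_1^s=s$ and $a_n^s=a_{n-1}^s+\operatorname{lcm}(n,a_{n-1}^s)$ for $n\geq 2$. Each $a_n^s$ is a multiple of $a_{n-1}^s$, and one sets $b_n^s=\frac{a_n^s}{a_{n-1}^s}-1$ for $n\ge 2$, which is a positive integer. A composite integer $m\geq 3$ is called a present number if there exist integers $n\ge 2$ and $s\geq 1$ such that $b_n^s=m$; otherwise it is called an absent number. For positive integers $q$ and $m$, $q\vartriangleleft m$ means that every prime divisor of $q$ is also a prime divisor of $m$ and $q<m$. *)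

theory Defs
  imports "HOL-Number_Theory.Number_Theory"
begin

text \<open>
  The sequence starts at index 1; the value at index 0 is a dummy that is never used.
\<close>

fun a_seq :: "nat \<Rightarrow> nat \<Rightarrow> nat" where
  "a_seq s 0 = 0"
| "a_seq s (Suc 0) = s"
| "a_seq s (Suc (Suc n)) = a_seq s (Suc n) + lcm (Suc (Suc n)) (a_seq s (Suc n))"

text \<open>
  Division and subtraction are on natural numbers. For \<open>s \<ge> 1\<close> and \<open>n \<ge> 2\<close>, the only
  arguments of interest, neither of them loses information (see \<open>b_seq_exact\<close> below).
\<close>

definition b_seq :: "nat \<Rightarrow> nat \<Rightarrow> nat" where
  "b_seq s n = a_seq s n div a_seq s (n - 1) - 1"

definition present_number :: "nat \<Rightarrow> bool" where
  "present_number m \<longleftrightarrow> m \<ge> 3 \<and> \<not> prime m \<and> (\<exists>n\<ge>2. \<exists>s\<ge>1. b_seq s n = m)"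

definition absent_number :: "nat \<Rightarrow> bool" where
  "absent_number m \<longleftrightarrow> m \<ge> 3 \<and> \<not> prime m \<and> \<not> present_number m"

definition prec_rad :: "nat \<Rightarrow> nat \<Rightarrow> bool" (infix \<open>\<triangleleft>\<close> 50) where
  "q \<triangleleft> m \<longleftrightarrow> (\<forall>r. prime r \<and> r dvd q \<longrightarrow> r dvd m) \<and> q < m"

lemma a_seq_rec:
  assumes "n \<ge> 2"
  shows "a_seq s n = a_seq s (n - 1) + lcm n (a_seq s (n - 1))"
proof -
  obtain k where "n = Suc (Suc k)"
    using assms that[of "n - 2"] by simp
  then show ?thesis by simp
qed

lemma a_seq_pos:
  assumes "s \<ge> 1" and "n \<ge> 1"
  shows "a_seq s n > 0"
  using assms by (induction s n rule: a_seq.induct) auto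

lemma a_seq_dvd:
  assumes "n \<ge> 2"
  shows "a_seq s (n - 1) dvd a_seq s n"
  by (subst a_seq_rec[OF assms]) simp

lemma b_seq_exact:
  assumes "s \<ge> 1" and "n \<ge> 2"
  shows "real (b_seq s n) = real (a_seq s n) / real (a_seq s (n - 1)) - 1"
    and "b_seq s n > 0"
proof -
  have pos: "a_seq s (n - 1) > 0"
    using assms by (intro a_seq_pos) auto
  obtain k where k: "lcm n (a_seq s (n - 1)) = a_seq s (n - 1) * k"
    by (rule dvdE[OF dvd_lcm2])
  have "lcm n (a_seq s (n - 1)) > 0"
    using pos assms by (intro lcm_pos_nat) auto
  then have kpos: "k > 0" using k by (cases k) auto
  have eq: "a_seq s n = a_seq s (n - 1) * Suc k"
    unfolding a_seq_rec[OF assms(2), of s] k by simp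
  have b: "b_seq s n = k"
    unfolding b_seq_def eq using pos by simp
  show "real (b_seq s n) = real (a_seq s n) / real (a_seq s (n - 1)) - 1"
    unfolding b eq using pos by (simp add: field_simps)
  show "b_seq s n > 0" using b kpos by simp
qed

end

theory Submission
  imports Defs
begin

text \<open>
  Since \<open>lcm n a = a * (n div gcd n a)\<close>, the recursion is multiplicative: with
  \<open>b\<^sub>n = n div gcd n a\<^sub>n\<^sub>-\<^sub>1\<close> one has \<open>a\<^sub>n = a\<^sub>n\<^sub>-\<^sub>1 * (1 + b\<^sub>n)\<close>. Hence \<open>a\<close> grows along divisibility, and
  \<open>a\<close> gains a factor \<open>p\<close> at step \<open>n\<close> exactly when \<open>b\<^sub>n \<equiv> -1\<close> modulo \<open>p\<close>.

  Suppose that \<open>q \<triangleleft> m\<close> and \<open>q \<equiv> -1\<close> modulo a prime divisor \<open>p\<close> of \<open>m\<close>. If \<open>b\<^sub>n = m\<close>, then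
  \<open>n = m * g\<close> with \<open>g = gcd n a\<^sub>n\<^sub>-\<^sub>1\<close>, and \<open>a\<^sub>n\<^sub>-\<^sub>1\<close> has the same valuation as \<open>g\<close> at every
  prime divisor of \<open>m\<close>. As \<open>q * g < n\<close>, the valuations of \<open>a\<close> at index \<open>q * g\<close> are at most those
  of \<open>g\<close>. No \<open>g\<close> has this property, by descent (\<open>no_bounded_multiple\<close>): if \<open>g\<close> divides the term at
  index \<open>q * g - 1\<close>, then \<open>b\<close> takes the value \<open>q\<close> at index \<open>q * g\<close>, which puts one more factor \<open>p\<close>
  into \<open>a\<close> and exceeds the bound; otherwise the gcd of \<open>g\<close> with that term is a smaller number with
  the same property. So \<open>m\<close> is absent.

  Conversely, if there is no such pair, start with an \<open>s\<close> that is coprime to \<open>m\<close> but divisible by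
  high powers of all primes below \<open>m\<close> that do not divide \<open>m\<close>. For \<open>k < m\<close>, only prime divisors of
  \<open>m\<close> can then survive in \<open>b\<^sub>k\<close>, so \<open>b\<^sub>k \<triangleleft> m\<close>; by assumption \<open>1 + b\<^sub>k\<close> is coprime to \<open>m\<close>, and
  inductively so is \<open>a\<^sub>k\<close>. At \<open>k = m\<close> nothing cancels and \<open>b\<^sub>m = m\<close>
  (\<open>b_seq_eq_index_if_no_pair\<close>).
\<close>

section \<open>The multiplicative form of the recursion\<close>

lemma b_seq_times_gcd:
  assumes "s \<ge> 1" and "n \<ge> 2"
  shows "b_seq s n * gcd n (a_seq s (n - 1)) = n"
    and "a_seq s n = a_seq s (n - 1) * (1 + b_seq s n)"
proof -
  define A where "A = a_seq s (n - 1)"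
  define g where "g = gcd n A"
  have A: "A > 0" unfolding A_def using assms by (intro a_seq_pos) auto
  have n: "n = (n div g) * g" by (simp add: g_def)
  have "lcm n A * g = A * (n div g) * g"
    using prod_gcd_lcm_nat[of n A] by (simp add: g_def mult_ac)
  moreover have "g > 0" using A by (simp add: g_def)
  ultimately have lcm: "lcm n A = A * (n div g)" by simp
  have a: "a_seq s n = A * (1 + n div g)"
    using a_seq_rec[OF assms(2), of s] lcm by (simp add: A_def algebra_simps)
  have b: "b_seq s n = n div g"
    unfolding b_seq_def a A_def[symmetric] using A by simp
  show "b_seq s n * gcd n (a_seq s (n - 1)) = n"
    unfolding b using n by (simp add: g_def A_def)
  show "a_seq s n = a_seq s (n - 1) * (1 + b_seq s n)"
    unfolding b a by (simp add: A_def)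
qed

lemma a_seq_dvd_mono:
  assumes "1 \<le> i" and "i \<le> j"
  shows "a_seq s i dvd a_seq s j"
  using assms(2)
proof (induction j rule: dec_induct)
  case (step j)
  have "a_seq s j dvd a_seq s (Suc j)"
    using a_seq_dvd[of "Suc j" s] step.hyps assms(1) by simp
  with step.IH show ?case by (rule dvd_trans)
qed simp

section \<open>Obstruction by a residue of minus one\<close>

text \<open>
  Descent on \<open>g\<close>: replace it by its gcd \<open>h\<close> with the term at index \<open>q * g - 1\<close>. If \<open>h < g\<close>,
  then index \<open>q * h\<close> comes no later than \<open>q * g - 1\<close>, so the bound passes to \<open>h\<close>. If \<open>h = g\<close>, the
  bound makes the cofactor of \<open>g\<close> in that term coprime to \<open>q\<close>, hence \<open>b\<close> equals \<open>q\<close> at index \<open>q * g\<close>,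
  and the factor \<open>1 + q\<close> violates the bound at \<open>p\<close>. The bound compares valuations at the prime
  divisors of \<open>m\<close>; stating it through prime powers lets it pass directly to a gcd.
\<close>

lemma no_bounded_multiple:
  fixes m p q g :: nat
  assumes s: "s \<ge> 1" and p: "prime p" "p dvd m" and q: "q \<ge> 2" "p dvd q + 1"
    and supp: "\<And>r. prime r \<Longrightarrow> r dvd q \<Longrightarrow> r dvd m"
    and "g > 0"
    and bound: "\<And>r j. prime r \<Longrightarrow> r dvd m \<Longrightarrow> r ^ j dvd a_seq s (q * g) \<Longrightarrow> r ^ j dvd g"
  shows False
  using \<open>g > 0\<close> bound
proof (induction g rule: less_induct)
  case (less g)
  define A where "A = a_seq s (q * g - 1)"
  define h where "h = gcd g A"
  have "2 * 1 \<le> q * g" using q(1) less.prems(1) by (intro mult_le_mono) auto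
  hence idx: "q * g \<ge> 2" by simp
  note rec = b_seq_times_gcd[OF s idx, folded A_def]
  have h: "h > 0" "h \<le> g"
    using less.prems(1) by (auto simp: h_def intro: gcd_le1_nat)
  have A_dvd: "A dvd a_seq s (q * g)" using rec(2) by simp
  show False
  proof (cases "h = g")
    case False
    with h have "h < g" by simp
    hence "q * h < q * g" using q(1) by simp
    hence "q * h \<le> q * g - 1" by linarith
    moreover have "1 \<le> q * h" using q(1) h(1) by (simp add: Suc_le_eq)
    ultimately have "a_seq s (q * h) dvd A"
      unfolding A_def by (intro a_seq_dvd_mono) auto
    hence "r ^ j dvd h" if "prime r" "r dvd m" "r ^ j dvd a_seq s (q * h)" for r j
      using less.prems(2)[OF that(1,2), of j] that(3) A_dvd
      unfolding h_def by (meson dvd_trans gcd_greatest)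
    with less.IH[OF \<open>h < g\<close> h(1)] show False by blast
  next
    case True
    hence "g dvd A" unfolding h_def by (metis gcd_dvd2)
    then obtain c where c: "A = g * c" by (rule dvdE)
    have too_many: False if "prime r" "r dvd m" "g * r dvd a_seq s (q * g)" for r
    proof -
      have "r ^ multiplicity r g dvd g" by (rule multiplicity_dvd)
      hence "r ^ Suc (multiplicity r g) dvd a_seq s (q * g)"
        using that(3) by (metis dvd_trans mult_dvd_mono dvd_refl power_Suc2)
      hence "r ^ Suc (multiplicity r g) dvd g"
        using less.prems(2) that(1,2) by blast
      thus False
        using that(1) less.prems(1)
        by (subst (asm) power_dvd_iff_le_multiplicity) auto
    qed
    have "coprime q c"
    proof (rule ccontr)
      assume "\<not> coprime q c"
      hence "gcd q c \<noteq> 1" using coprime_iff_gcd_eq_1 by blast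
      then obtain r where "prime r" "r dvd gcd q c" using prime_factor_nat by blast
      hence r: "prime r" "r dvd q" "r dvd c" by auto
      have "g * r dvd A" unfolding c using r(3) by (intro mult_dvd_mono dvd_refl)
      hence "g * r dvd a_seq s (q * g)" using A_dvd by (rule dvd_trans)
      thus False using too_many[OF r(1) supp[OF r(1,2)]] by blast
    qed
    hence "gcd (q * g) A = g"
      unfolding c mult.commute[of q] gcd_mult_distrib_nat[symmetric] by simp
    with rec(1) less.prems(1) have "b_seq s (q * g) = q" by simp
    hence "a_seq s (q * g) = g * c * (q + 1)" using rec(2) c by simp
    hence "g * p dvd a_seq s (q * g)"
      using q(2) by (simp add: mult.assoc del: mult_Suc_right)
    thus False using too_many[OF p] by blast
  qed
qed

lemma b_seq_neq_if_pair:
  fixes m p q :: nat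
  assumes "s \<ge> 1" and "n \<ge> 2" and "prime p" "p dvd m" and "q \<ge> 2" "p dvd q + 1" and "q \<triangleleft> m"
  shows "b_seq s n \<noteq> m"
proof
  assume b: "b_seq s n = m"
  define A where "A = a_seq s (n - 1)"
  define g where "g = gcd n A"
  have n: "n = m * g"
    using b_seq_times_gcd(1)[OF assms(1,2)] b by (simp add: g_def A_def)
  have g: "g > 0" using n assms(2) by (cases "g = 0") auto
  have m: "q < m" and supp: "\<And>r. prime r \<Longrightarrow> r dvd q \<Longrightarrow> r dvd m"
    using assms(7) by (auto simp: prec_rad_def)
  obtain c where c: "A = g * c" unfolding g_def by (rule dvdE[OF gcd_dvd2])
  \<comment> \<open>So \<open>A\<close> and \<open>g\<close> have equal valuations at the prime divisors of \<open>m\<close>.\<close>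
  have "g * gcd m c = g * 1"
    using g_def n c by (metis gcd_mult_distrib_nat mult.commute mult.right_neutral)
  hence "gcd m c = 1" using g by simp
  hence cop: "coprime m c" by (rule coprime_iff_gcd_eq_1[THEN iffD2])
  have "q * g < n" using n m g by simp
  moreover have "1 \<le> q * g" using assms(5) g by (simp add: Suc_le_eq)
  ultimately have dvd: "a_seq s (q * g) dvd A"
    unfolding A_def by (intro a_seq_dvd_mono) auto
  have "r ^ j dvd g" if "prime r" "r dvd m" "r ^ j dvd a_seq s (q * g)" for r j
  proof -
    have "coprime r c" using cop that(2) by (rule coprime_divisors[OF _ dvd_refl, rotated])
    hence "coprime (r ^ j) c" by simp
    moreover have "r ^ j dvd g * c" using that(3) dvd c by (metis dvd_trans)
    ultimately show ?thesis by (simp add: coprime_dvd_mult_left_iff)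
  qed
  from no_bounded_multiple[OF assms(1) assms(3,4) assms(5,6) supp g this] show False by blast
qed

section \<open>A starting value in the unobstructed case\<close>

text \<open>
  The base of the power is the product of all units modulo \<open>m\<close> below \<open>m\<close>, so it contains every
  prime below \<open>m\<close> that does not divide \<open>m\<close>; the exponent \<open>m\<close> exceeds every exponent that occurs in
  an index below \<open>m\<close>.
\<close>

lemma exists_saturated_start:
  fixes m :: nat
  obtains s where "s \<ge> 1" and "coprime s m"
    and "\<And>r j k. prime r \<Longrightarrow> \<not> r dvd m \<Longrightarrow> 1 \<le> k \<Longrightarrow> k < m \<Longrightarrow> r ^ j dvd k \<Longrightarrow> r ^ j dvd s"
proof -
  define U where "U = {i \<in> {1..<m}. coprime i m}"
  define s where "s = (\<Prod>U) ^ m"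
  have fin: "finite U" by (simp add: U_def)
  have "\<Prod>U \<noteq> 0" using fin by (auto simp: U_def)
  hence "s \<ge> 1" by (simp add: s_def Suc_le_eq)
  moreover have "coprime s m"
    unfolding s_def by (intro coprime_power_left_iff[THEN iffD2] disjI1 prod_coprime_left)
      (auto simp: U_def)
  moreover have "r ^ j dvd s"
    if "prime r" "\<not> r dvd m" "1 \<le> k" "k < m" "r ^ j dvd k" for r j k
  proof (cases "j = 0")
    case False
    have le: "r ^ j \<le> k" using that(3,5) by (intro dvd_imp_le) auto
    have "j < 2 ^ j" by (rule less_exp)
    also have "(2::nat) ^ j \<le> r ^ j" using prime_ge_2_nat[OF that(1)] by (rule power_mono) simp
    finally have "j \<le> m" using le that(4) by simp
    have "r \<le> r ^ j" using False prime_gt_0_nat[OF that(1)] by (intro self_le_power) auto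
    hence "r \<in> U"
      using le that(4) prime_gt_0_nat[OF that(1)] prime_imp_coprime[OF that(1,2)]
      by (simp add: U_def)
    hence "r dvd \<Prod>U" using dvd_prodI[OF fin, of r "\<lambda>x. x"] by simp
    hence "r ^ m dvd s" unfolding s_def by (rule dvd_power_same)
    thus ?thesis using le_imp_power_dvd[OF \<open>j \<le> m\<close>, of r] by (rule dvd_trans[rotated])
  qed simp
  ultimately show ?thesis using that by blast
qed

lemma b_seq_eq_index_if_no_pair:
  fixes m :: nat
  assumes "m \<ge> 2"
    and no_pair: "\<And>p q. prime p \<Longrightarrow> p dvd m \<Longrightarrow> q > 0 \<Longrightarrow> q \<triangleleft> m \<Longrightarrow> \<not> p dvd q + 1"
  obtains s where "s \<ge> 1" and "b_seq s m = m"
proof -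
  obtain s where s: "s \<ge> 1" "coprime s m"
    and sat: "\<And>r j k. prime r \<Longrightarrow> \<not> r dvd m \<Longrightarrow> 1 \<le> k \<Longrightarrow> k < m \<Longrightarrow> r ^ j dvd k \<Longrightarrow> r ^ j dvd s"
    using exists_saturated_start[of m] by blast
  have cop: "coprime (a_seq s k) m" if "1 \<le> k" "k < m" for k
    using that
  proof (induction k rule: nat_induct_at_least)
    case base
    show ?case using s(2) by simp
  next
    case (Suc k)
    define b where "b = b_seq s (Suc k)"
    define g where "g = gcd (Suc k) (a_seq s k)"
    have k2: "Suc k \<ge> 2" using Suc.hyps by simp
    have bg: "b * g = Suc k" and a: "a_seq s (Suc k) = a_seq s k * (1 + b)"
      using b_seq_times_gcd[OF s(1) k2] by (simp_all add: b_def g_def)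
    have b_pos: "b > 0" using bg by (cases "b = 0") auto
    have s_dvd: "s dvd a_seq s k" using a_seq_dvd_mono[of 1 k s] Suc.hyps by simp
    have "r dvd m" if r: "prime r" "r dvd b" for r
    proof (rule ccontr)
      assume "\<not> r dvd m"
      define j where "j = multiplicity r (Suc k)"
      have "r ^ j dvd Suc k" unfolding j_def by (rule multiplicity_dvd)
      moreover from this have "r ^ j dvd s"
        using sat[OF r(1) \<open>\<not> r dvd m\<close>, of "Suc k" j] Suc.prems by simp
      \<comment> \<open>The full power of \<open>r\<close> in the index already cancels, so no factor \<open>r\<close> is left for \<open>b\<close>.\<close>
      ultimately have "r ^ j dvd g"
        unfolding g_def using s_dvd by (meson dvd_trans gcd_greatest)
      hence "r ^ Suc j dvd Suc k"
        using r(2) bg by (metis mult_dvd_mono power_Suc)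
      thus False
        using r(1) unfolding j_def
        by (subst (asm) power_dvd_iff_le_multiplicity) auto
    qed
    moreover have "b < m"
    proof -
      have "b \<le> Suc k" using bg by (intro dvd_imp_le) (auto intro: dvdI[OF sym])
      thus ?thesis using Suc.prems by simp
    qed
    ultimately have "b \<triangleleft> m" by (auto simp: prec_rad_def)
    hence "\<not> p dvd 1 + b" if "prime p" "p dvd m" for p
      using no_pair[OF that b_pos] by (simp add: add.commute)
    hence "gcd (1 + b) m = 1"
      using prime_factor_nat[of "gcd (1 + b) m"] by (meson gcd_dvd1 gcd_dvd2 dvd_trans)
    hence "coprime (1 + b) m" by (rule coprime_iff_gcd_eq_1[THEN iffD2])
    moreover have "coprime (a_seq s k) m" using Suc by simp
    ultimately show ?case unfolding a by (simp only: coprime_mult_left_iff)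
  qed
  have "coprime m (a_seq s (m - 1))"
    using cop[of "m - 1"] assms(1) by (simp add: coprime_commute)
  hence "b_seq s m = m" using b_seq_times_gcd(1)[OF s(1) assms(1)] by simp
  with s(1) show ?thesis by (rule that)
qed

lemma cong_minus_one_iff_dvd: "[int q = - 1] (mod int p) \<longleftrightarrow> p dvd q + 1"
proof -
  have "[int q = - 1] (mod int p) \<longleftrightarrow> int p dvd int (q + 1)"
    by (simp add: cong_iff_dvd_diff add.commute)
  thus ?thesis by (simp only: int_dvd_int_iff)
qed

theorem theorem13:
  fixes m :: nat
  assumes "m \<ge> 3" and "odd m" and "\<not> prime m"
  shows "((\<exists>p q. prime p \<and> p dvd m \<and> q > 0 \<and> q \<triangleleft> m \<and> [int q = - 1] (mod int p))
            \<longrightarrow> absent_number m) \<and>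
         (\<not> (\<exists>p q. prime p \<and> p dvd m \<and> q > 0 \<and> q \<triangleleft> m \<and> [int q = - 1] (mod int p))
            \<longrightarrow> (\<exists>s\<ge>1. b_seq s m = m) \<and> present_number m)"
proof (intro conjI impI)
  assume "\<exists>p q. prime p \<and> p dvd m \<and> q > 0 \<and> q \<triangleleft> m \<and> [int q = - 1] (mod int p)"
  then obtain p q where pq: "prime p" "p dvd m" "q > 0" "q \<triangleleft> m" "p dvd q + 1"
    by (auto simp: cong_minus_one_iff_dvd)
  \<comment> \<open>This is where the parity of \<open>m\<close> enters: \<open>q = 1\<close> would force \<open>p = 2\<close>.\<close>
  have "q \<noteq> 1"
  proof
    assume "q = 1"
    with pq(5) have "p dvd 2" by (simp add: numeral_2_eq_2)
    with pq(1) have "p = 2" by (metis primes_dvd_imp_eq two_is_prime_nat)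
    with pq(2) assms(2) show False by simp
  qed
  with pq(3) have "q \<ge> 2" by simp
  have "\<not> present_number m"
    using b_seq_neq_if_pair[OF _ _ pq(1,2) \<open>q \<ge> 2\<close> pq(5,4)] by (auto simp: present_number_def)
  thus "absent_number m" using assms by (simp add: absent_number_def)
next
  assume "\<not> (\<exists>p q. prime p \<and> p dvd m \<and> q > 0 \<and> q \<triangleleft> m \<and> [int q = - 1] (mod int p))"
  hence no_pair: "\<not> p dvd q + 1" if "prime p" "p dvd m" "q > 0" "q \<triangleleft> m" for p q
    using that by (auto simp: cong_minus_one_iff_dvd)
  have "m \<ge> 2" using assms(1) by simp
  from b_seq_eq_index_if_no_pair[OF this no_pair]
  show ex: "\<exists>s\<ge>1. b_seq s m = m" by blast
  with \<open>m \<ge> 2\<close> show "present_number m" using assms by (auto simp: present_number_def)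
qed

end
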